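(* Let $u$ and $v$ be distinct strongly cospectral vertices in an oriented graph $\Gamma$, with phase factors $e^{\mathrm{i}\pi q_r(u,v)}$, let $\alpha,\beta$ be nonzero real numbers and let $t\in\mathbb{R}$. Then $\Gamma$ admits $(\alpha,\beta)$-FR from $u$ to $v$ at time $t$ if and only if for each $\lambda_r\in\phi_u$ (i.e. each index $r$ with $\lambda_r\in\phi_u$), $$\mathrm{Re}\left(e^{\lambda_r t}\right)=\alpha,\qquad \mathrm{Im}\left(e^{\lambda_r t}\right)=\pm\beta \ \ (\text{i.e. } \mathrm{Im}(e^{\lambda_r t})\in\{\beta,-\beta\}),$$ and $$e^{\mathrm{i}\pi q_r(u,v)}=-\frac{\mathrm{Im}\left(e^{\lambda_r t}\right)}{\beta}\,\mathrm{i}.$$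
   Context: An oriented graph $\Gamma$ is a finite graph with vertex set $V(\Gamma)$ and edge set $E(\Gamma)\subseteq V(\Gamma)\times V(\Gamma)$ such that $(u,v)\in E(\Gamma)$ implies $(v,u)\notin E(\Gamma)$. Its adjacency matrix $A_\Gamma=[a_{uv}]$ has $a_{uv}=1$ if $(u,v)\in E(\Gamma)$, $a_{uv}=-1$ if $(v,u)\in E(\Gamma)$, and $a_{uv}=0$ otherwise (a real skew-symmetric matrix). The transition matrix is $U(t)=\exp(A_\Gamma t)$, $t\in\mathbb{R}$. $\mathbf{e}_u$ is the standard basis vector indexed by $u$. Fractional revival: for distinct vertices $u,v$ and real numbers $\alpha,\beta$ with $\alpha^2+\beta^2=1$, $\beta\neq0$, $\Gamma$ admits $(\alpha,\beta)$-FR from $u$ to $v$ at time $t$ if $U(t)\mathbf{e}_u=\alpha\mathbf{e}_u+\beta\mathbf{e}_v$. Let $n=|V(\Gamma)|$, let $\lambda_1,\dots,\lambda_n$ be the eigenvalues of $A_\Gamma$ (with multiplicity) with corresponding orthonormal eigenvectors $\mathbf{x}_1,\dots,\mathbf{x}_n$ (fixed), and put $E_{\lambda_r}=\mathbf{x}_r\mathbf{x}_r^H$ for each index $r$, where $^H$ is conjugate transpose. Vertices $u,v$ are strongly cospectral if for every $r\in\{1,\dots,n\}$ there is a phase factor $e^{\mathrm{i}\pi q_r(u,v)}$ (with $q_r(u,v)\in\mathbb{R}$) such that $E_{\lambda_r}\mathbf{e}_u=e^{\mathrm{i}\pi q_r(u,v)}E_{\lambda_r}\mathbf{e}_v$,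 with the condition that $\lambda_i=\lambda_j$ implies $e^{\mathrm{i}\pi q_i(u,v)}=e^{\mathrm{i}\pi q_j(u,v)}$. The eigenvalue support $\phi_u$ of $u$ is the set of eigenvalues $\lambda_r$ for which $E_{\lambda_r}\mathbf{e}_u\neq\mathbf{0}$. *)

theory Defs
  imports "HOL-Analysis.Analysis"
begin

text \<open>The vertex set is a finite type; \<open>(u, v) \<in> E\<close> is the directed edge from \<open>u\<close> to \<open>v\<close>.\<close>

definition oriented_graph :: "('v::finite \<times> 'v) set \<Rightarrow> bool" where
  "oriented_graph E \<longleftrightarrow> (\<forall>u v. (u, v) \<in> E \<longrightarrow> (v, u) \<notin> E)"

definition adj_matrix :: "('v::finite \<times> 'v) set \<Rightarrow> real^'v^'v" where
  "adj_matrix E = (\<chi> u v. if (u, v) \<in> E then 1 else if (v, u) \<in> E then -1 else 0)"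

definition complex_matrix :: "real^'n^'m \<Rightarrow> complex^'n^'m" where
  "complex_matrix A = (\<chi> i j. complex_of_real (A $ i $ j))"

text \<open>The exponential series with respect to the matrix product. (The multiplication \<open>*\<close>
  on \<open>real^'n^'n\<close> is componentwise, so \<open>^\<close> and \<open>exp\<close> would not be the notions wanted here.)\<close>

primrec matrix_power :: "real^'n^'n \<Rightarrow> nat \<Rightarrow> real^'n^'n" where
  "matrix_power A 0 = mat 1"
| "matrix_power A (Suc k) = A ** matrix_power A k"

definition matrix_exp :: "real^'n^'n \<Rightarrow> real^'n^'n" where
  "matrix_exp A = (\<Sum>k. (1 / fact k) *\<^sub>R matrix_power A k)"

definition transition_matrix :: "('v::finite \<times> 'v) set \<Rightarrow> real \<Rightarrow> real^'v^'v" where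
  "transition_matrix E t = matrix_exp (t *\<^sub>R adj_matrix E)"

definition fractional_revival ::
    "('v::finite \<times> 'v) set \<Rightarrow> real \<Rightarrow> real \<Rightarrow> 'v \<Rightarrow> 'v \<Rightarrow> real \<Rightarrow> bool" where
  "fractional_revival E \<alpha> \<beta> u v t \<longleftrightarrow>
     u \<noteq> v \<and> \<alpha>\<^sup>2 + \<beta>\<^sup>2 = 1 \<and> \<beta> \<noteq> 0 \<and>
     transition_matrix E t *v axis u 1 = \<alpha> *\<^sub>R axis u 1 + \<beta> *\<^sub>R axis v 1"

text \<open>The library inner product \<open>\<bullet>\<close> on \<open>complex^'n\<close> is only the real part of this one.\<close>

definition hermitian_inner :: "complex^'n \<Rightarrow> complex^'n \<Rightarrow> complex" where
  "hermitian_inner x y = (\<Sum>i\<in>UNIV. cnj (x $ i) * y $ i)"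

text \<open>Since there are \<open>CARD('v)\<close> orthonormal, hence linearly independent, eigenvectors,
  \<open>lam\<close> lists every eigenvalue as often as its multiplicity. Only the indices
  \<open>1, \<dots>, CARD('v)\<close> matter.\<close>

definition orthonormal_eigensystem ::
    "('v::finite \<times> 'v) set \<Rightarrow> (nat \<Rightarrow> complex) \<Rightarrow> (nat \<Rightarrow> complex^'v) \<Rightarrow> bool" where
  "orthonormal_eigensystem E lam x \<longleftrightarrow>
     (\<forall>r\<in>{1..CARD('v)}. complex_matrix (adj_matrix E) *v x r = lam r *s x r) \<and>
     (\<forall>r\<in>{1..CARD('v)}. \<forall>s\<in>{1..CARD('v)}.
        hermitian_inner (x r) (x s) = (if r = s then 1 else 0))"

text \<open>The rank-one projection \<open>x x\<^sup>H\<close>.\<close>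

definition eigenprojection :: "complex^'n \<Rightarrow> complex^'n^'n" where
  "eigenprojection x = (\<chi> i j. x $ i * cnj (x $ j))"

definition strongly_cospectral_phases ::
    "(nat \<Rightarrow> complex) \<Rightarrow> (nat \<Rightarrow> complex^'v) \<Rightarrow> 'v::finite \<Rightarrow> 'v \<Rightarrow> (nat \<Rightarrow> real) \<Rightarrow> bool" where
  "strongly_cospectral_phases lam x u v q \<longleftrightarrow>
     (\<forall>r\<in>{1..CARD('v)}. eigenprojection (x r) *v axis u 1 =
        exp (\<i> * of_real (pi * q r)) *s (eigenprojection (x r) *v axis v 1)) \<and>
     (\<forall>i\<in>{1..CARD('v)}. \<forall>j\<in>{1..CARD('v)}. lam i = lam j \<longrightarrow>
        exp (\<i> * of_real (pi * q i)) = exp (\<i> * of_real (pi * q j)))"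

definition eigenvalue_support ::
    "(nat \<Rightarrow> complex) \<Rightarrow> (nat \<Rightarrow> complex^'v) \<Rightarrow> 'v::finite \<Rightarrow> complex set" where
  "eigenvalue_support lam x u =
     {lam r | r. r \<in> {1..CARD('v)} \<and> eigenprojection (x r) *v axis u 1 \<noteq> 0}"

end

theory Submission
  imports Defs
begin

text \<open>Since the adjacency matrix is real and skew-symmetric, its eigenvalues are purely imaginary and
  each \<open>x\<^sub>r\<^sup>H\<close> is a left eigenvector of \<open>U(t)\<close>. Pairing with the orthonormal basis turns
  fractional revival into the scalar equations
  \<open>e\<^bsup>\<lambda>t\<^esup> cnj (x\<^sub>r u) = \<alpha> cnj (x\<^sub>r u) + \<beta> cnj (x\<^sub>r v)\<close>, which on the eigenvalue support of \<open>u\<close>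
  say \<open>e\<^bsup>\<lambda>t\<^esup> \<omega>\<^sub>r = \<alpha> \<omega>\<^sub>r + \<beta>\<close> for the phase factor \<open>\<omega>\<^sub>r\<close>. Taking moduli forces \<open>Re \<omega>\<^sub>r = 0\<close>.\<close>

lemma adj_matrix_skew:
  assumes "oriented_graph E"
  shows "adj_matrix E $ j $ i = - (adj_matrix E $ i $ j)"
  using assms unfolding oriented_graph_def adj_matrix_def by auto

section \<open>Convergence of the matrix exponential series\<close>

lemma abs_matrix_power_le:
  fixes A :: "real^'n^'n"
  shows "\<bar>matrix_power A k $ i $ j\<bar> \<le> (\<Sum>a\<in>UNIV. \<Sum>b\<in>UNIV. \<bar>A $ a $ b\<bar>) ^ k"
proof (induction k arbitrary: i)
  case 0
  then show ?case by (simp add: mat_def)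
next
  case (Suc k)
  let ?S = "\<Sum>a\<in>UNIV. \<Sum>b\<in>UNIV. \<bar>A $ a $ b\<bar>"
  have "\<bar>matrix_power A (Suc k) $ i $ j\<bar> \<le> (\<Sum>l\<in>UNIV. \<bar>A $ i $ l\<bar> * \<bar>matrix_power A k $ l $ j\<bar>)"
    by (simp add: matrix_matrix_mult_def flip: abs_mult)
  also have "\<dots> \<le> (\<Sum>l\<in>UNIV. \<bar>A $ i $ l\<bar> * ?S ^ k)"
    by (intro sum_mono mult_left_mono Suc.IH) auto
  also have "\<dots> = (\<Sum>l\<in>UNIV. \<bar>A $ i $ l\<bar>) * ?S ^ k"
    by (simp add: sum_distrib_right)
  \<comment> \<open>The sum over row \<open>i\<close> is one of the nonnegative row sums that add up
    to \<open>?S\<close>.\<close>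
  also have "\<dots> \<le> ?S * ?S ^ k"
    by (intro mult_right_mono member_le_sum[where f = "\<lambda>a. \<Sum>b\<in>UNIV. \<bar>A $ a $ b\<bar>"]
        zero_le_power sum_nonneg) auto
  finally show ?case by simp
qed

lemma norm_matrix_le_sum_abs:
  fixes M :: "real^'n^'m"
  shows "norm M \<le> (\<Sum>i\<in>UNIV. \<Sum>j\<in>UNIV. \<bar>M $ i $ j\<bar>)"
proof -
  have "norm M \<le> (\<Sum>i\<in>UNIV. norm (M $ i))"
    unfolding norm_vec_def by (rule L2_set_le_sum) auto
  also have "\<dots> \<le> (\<Sum>i\<in>UNIV. \<Sum>j\<in>UNIV. \<bar>M $ i $ j\<bar>)"
    by (intro sum_mono norm_le_l1_cart)
  finally show ?thesis .
qed

text \<open>An infinite sum is only usable once convergence is known. By the entrywise bound, the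
  norm of the k-th power is at most \<open>?S ^ k\<close> times the number of entries, so the scalar
  exponential series at \<open>?S\<close> dominates.\<close>

lemma matrix_exp_sums:
  fixes A :: "real^'n^'n"
  shows "(\<lambda>k. (1 / fact k) *\<^sub>R matrix_power A k) sums matrix_exp A"
  unfolding matrix_exp_def
proof (rule summable_sums, rule summable_comparison_test', rule summable_mult)
  let ?S = "\<Sum>a\<in>UNIV. \<Sum>b\<in>UNIV. \<bar>A $ a $ b\<bar>"
  show "summable (\<lambda>k. inverse (fact k) * ?S ^ k)"
    by (rule summable_exp)
  fix k :: nat
  have "norm (matrix_power A k) \<le> (\<Sum>i\<in>(UNIV :: 'n set). \<Sum>j\<in>(UNIV :: 'n set). ?S ^ k)"
    by (rule order_trans[OF norm_matrix_le_sum_abs]) (intro sum_mono abs_matrix_power_le)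
  then have "norm (matrix_power A k) \<le> (real CARD('n))\<^sup>2 * ?S ^ k"
    by (simp add: power2_eq_square)
  then show "norm ((1 / fact k) *\<^sub>R matrix_power A k)
      \<le> (real CARD('n))\<^sup>2 * (inverse (fact k) * ?S ^ k)"
    by (simp add: divide_simps)
qed

section \<open>Left eigenvectors and the spectrum of a real skew-symmetric matrix\<close>

lemma left_eigenvector_matrix_power:
  fixes B :: "real^'n^'n" and y :: "'n \<Rightarrow> complex"
  assumes "\<And>j. (\<Sum>i\<in>UNIV. y i * of_real (B $ i $ j)) = l * y j"
  shows "(\<Sum>i\<in>UNIV. y i * of_real (matrix_power B k $ i $ j)) = l ^ k * y j"
proof (induction k)
  case 0
  then show ?case by (simp add: mat_def if_distrib cong: if_cong)
next
  case (Suc k)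
  have "(\<Sum>i\<in>UNIV. y i * of_real (matrix_power B (Suc k) $ i $ j))
      = (\<Sum>i\<in>UNIV. \<Sum>m\<in>UNIV. y i * of_real (B $ i $ m) * of_real (matrix_power B k $ m $ j))"
    by (simp add: matrix_matrix_mult_def sum_distrib_left mult.assoc)
  also have "\<dots> = (\<Sum>m\<in>UNIV. (\<Sum>i\<in>UNIV. y i * of_real (B $ i $ m)) * of_real (matrix_power B k $ m $ j))"
    by (subst sum.swap) (simp add: sum_distrib_right)
  also have "\<dots> = l * (\<Sum>m\<in>UNIV. y m * of_real (matrix_power B k $ m $ j))"
    by (simp add: assms sum_distrib_left mult.assoc)
  finally show ?case by (simp add: Suc.IH mult.assoc)
qed

text \<open>Pairing column \<open>j\<close> of a matrix with \<open>y\<close> is a bounded linear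
  map, so it may be applied to the series term by term; the k-th power contributes
  \<open>l ^ k * y j\<close>, which leaves the scalar exponential series.\<close>

lemma left_eigenvector_matrix_exp:
  fixes B :: "real^'n^'n" and y :: "'n \<Rightarrow> complex"
  assumes "\<And>j. (\<Sum>i\<in>UNIV. y i * of_real (B $ i $ j)) = l * y j"
  shows "(\<Sum>i\<in>UNIV. y i * of_real (matrix_exp B $ i $ j)) = exp l * y j"
proof -
  have "bounded_linear (\<lambda>M :: real^'n^'n. \<Sum>i\<in>UNIV. y i * complex_of_real (M $ i $ j))"
    by (intro bounded_linear_sum bounded_linear_const_mult bounded_linear_of_real
        bounded_linear_compose[OF bounded_linear_of_real]
        bounded_linear_compose[OF bounded_linear_vec_nth] bounded_linear_vec_nth)
  from bounded_linear.sums[OF this matrix_exp_sums[of B]]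
  have "(\<lambda>k. (1 / fact k) *\<^sub>R (\<Sum>i\<in>UNIV. y i * of_real (matrix_power B k $ i $ j)))
      sums (\<Sum>i\<in>UNIV. y i * of_real (matrix_exp B $ i $ j))"
    by (simp add: sum_divide_distrib scaleR_conv_of_real[where 'a = complex])
  then have "(\<lambda>k. l ^ k /\<^sub>R fact k * y j)
      sums (\<Sum>i\<in>UNIV. y i * of_real (matrix_exp B $ i $ j))"
    by (simp add: left_eigenvector_matrix_power[OF assms] divide_inverse)
  moreover have "(\<lambda>k. l ^ k /\<^sub>R fact k * y j) sums (exp l * y j)"
    by (intro sums_mult2 exp_converges)
  ultimately show ?thesis by (rule sums_unique2)
qed

text \<open>Conjugating the eigenvector equation leaves the real entries of \<open>B\<close>
  unchanged, and transposing \<open>B\<close> costs a sign.\<close>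

lemma skew_left_eigenvector:
  fixes B :: "real^'n^'n" and x :: "complex^'n"
  assumes "\<And>i j. B $ j $ i = - (B $ i $ j)" and "complex_matrix B *v x = l *s x"
  shows "(\<Sum>i\<in>UNIV. cnj (x $ i) * of_real (B $ i $ j)) = - cnj l * cnj (x $ j)"
proof -
  have "(\<Sum>i\<in>UNIV. of_real (B $ j $ i) * x $ i) = l * x $ j"
    using assms(2) by (simp add: vec_eq_iff matrix_vector_mult_def complex_matrix_def)
  then have "cnj (\<Sum>i\<in>UNIV. of_real (B $ j $ i) * x $ i) = cnj l * cnj (x $ j)"
    by simp
  then have "(\<Sum>i\<in>UNIV. of_real (B $ j $ i) * cnj (x $ i)) = cnj l * cnj (x $ j)"
    by simp
  moreover have "cnj (x $ i) * of_real (B $ i $ j) = - (of_real (B $ j $ i) * cnj (x $ i))" for i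
    by (simp add: assms(1)[of i j])
  ultimately show ?thesis
    by (simp add: sum_negf)
qed

text \<open>The form \<open>x\<close>^H \<open>B\<close> \<open>x\<close> is evaluated twice: with
  \<open>x\<close>^H as a left eigenvector it equals \<open>- cnj l\<close>, with \<open>x\<close>
  as a right eigenvector it equals \<open>l\<close>.\<close>

lemma skew_eigenvalue_imaginary:
  fixes B :: "real^'n^'n" and x :: "complex^'n"
  assumes "\<And>i j. B $ j $ i = - (B $ i $ j)" and "complex_matrix B *v x = l *s x"
    and "hermitian_inner x x = 1"
  shows "cnj l = - l"
proof -
  have "(\<Sum>i\<in>UNIV. of_real (B $ i $ j) * x $ j * cnj (x $ i)) = - cnj l * (cnj (x $ j) * x $ j)" for j
    using arg_cong[OF skew_left_eigenvector[OF assms(1,2), of j], of "\<lambda>z. z * x $ j"]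
    by (simp add: sum_distrib_left sum_distrib_right mult_ac)
  then have "(\<Sum>j\<in>UNIV. \<Sum>i\<in>UNIV. of_real (B $ i $ j) * x $ j * cnj (x $ i))
      = - cnj l * hermitian_inner x x"
    by (simp add: hermitian_inner_def sum_distrib_left)
  moreover have "(\<Sum>j\<in>UNIV. of_real (B $ i $ j) * x $ j * cnj (x $ i)) = l * (cnj (x $ i) * x $ i)" for i
  proof -
    have "(\<Sum>j\<in>UNIV. of_real (B $ i $ j) * x $ j) = l * x $ i"
      using assms(2) by (simp add: vec_eq_iff matrix_vector_mult_def complex_matrix_def)
    then show ?thesis
      by (simp only: sum_distrib_right[symmetric]) (simp add: mult_ac)
  qed
  then have "(\<Sum>i\<in>UNIV. \<Sum>j\<in>UNIV. of_real (B $ i $ j) * x $ j * cnj (x $ i))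
      = l * hermitian_inner x x"
    by (simp add: hermitian_inner_def sum_distrib_left)
  ultimately have "l = - cnj l"
    using assms(3) by (subst (asm) sum.swap) simp
  then show ?thesis
    by (metis minus_minus)
qed

section \<open>Orthonormal families and coordinates\<close>

lemma orthonormal_complete:
  fixes x :: "nat \<Rightarrow> complex^'n" and w :: "complex^'n"
  assumes on: "\<And>r s. r \<in> {1..CARD('n)} \<Longrightarrow> s \<in> {1..CARD('n)} \<Longrightarrow>
      hermitian_inner (x r) (x s) = (if r = s then 1 else 0)"
    and zero: "\<And>r. r \<in> {1..CARD('n)} \<Longrightarrow> hermitian_inner (x r) w = 0"
  shows "w = 0"
proof -
  \<comment> \<open>The vectors are numbered by naturals, but matrix columns are indexed by the type
    \<open>'n\<close>; \<open>h\<close> translates.\<close>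
  obtain h where h: "bij_betw h (UNIV :: 'n set) {1..CARD('n)}"
    using finite_same_card_bij[of "UNIV :: 'n set" "{1..CARD('n)}"] by auto
  have hr: "h i \<in> {1..CARD('n)}" for i
    using h by (auto simp: bij_betw_def)
  have hi: "h i = h j \<longleftrightarrow> i = j" for i j
    using h by (auto simp: bij_betw_def inj_def)
  define P :: "complex^'n^'n" where "P = (\<chi> i j. x (h j) $ i)"
  define Q :: "complex^'n^'n" where "Q = (\<chi> i j. cnj (x (h i) $ j))"
  \<comment> \<open>\<open>Q\<close> is the conjugate transpose of \<open>P\<close>, so this product
    is the Gram matrix of the family. As \<open>P\<close> is square, \<open>Q\<close> is also a
    right inverse, whence \<open>w\<close> = \<open>P\<close> (\<open>Q\<close> \<open>w\<close>) =
    0.\<close>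
  have "Q ** P = mat 1"
    using on[OF hr hr]
    by (simp add: vec_eq_iff matrix_matrix_mult_def P_def Q_def mat_def hermitian_inner_def hi)
  then have "P ** Q = mat 1"
    by (simp add: matrix_left_right_inverse)
  moreover have "Q *v w = 0"
    using zero[OF hr]
    by (simp add: vec_eq_iff matrix_vector_mult_def Q_def hermitian_inner_def)
  ultimately show ?thesis
    by (metis matrix_vector_mul_assoc matrix_vector_mul_lid matrix_vector_mult_0_right)
qed

lemma hermitian_inner_combination:
  "hermitian_inner x (a *s y + b *s z) = a * hermitian_inner x y + b * hermitian_inner x z"
  by (simp add: hermitian_inner_def sum_distrib_left sum.distrib algebra_simps)

lemma hermitian_inner_axis: "hermitian_inner x (axis u 1) = cnj (x $ u)"
  by (simp add: hermitian_inner_def axis_def if_distrib cong: if_cong)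

lemma eigenprojection_axis: "eigenprojection x *v axis u 1 = cnj (x $ u) *s x"
  by (simp add: vec_eq_iff eigenprojection_def matrix_vector_mult_def axis_def if_distrib
      mult.commute cong: if_cong)

lemma matrix_vector_mult_axis: "((M :: real^'n^'m) *v axis u 1) $ i = M $ i $ u"
  by (simp add: matrix_vector_mult_def axis_def if_distrib cong: if_cong)

text \<open>The theorem at a single index. Multiplying by \<open>cnj w\<close>, the inverse of
  \<open>w\<close>, gives \<open>z\<close> = \<alpha> + \<beta> \<open>cnj w\<close>. Comparing
  squared moduli leaves only the cross term 2 \<alpha> \<beta> \<open>Re w\<close>, which must
  vanish.\<close>

lemma unit_phase_equation_iff:
  fixes z w :: complex and \<alpha> \<beta> :: real
  assumes "norm z = 1" and "norm w = 1" and "\<alpha> \<noteq> 0" and "\<beta> \<noteq> 0"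
  shows "\<alpha>\<^sup>2 + \<beta>\<^sup>2 = 1 \<and> z * w = of_real \<alpha> * w + of_real \<beta> \<longleftrightarrow>
    Re z = \<alpha> \<and> Im z \<in> {\<beta>, - \<beta>} \<and> w = - of_real (Im z / \<beta>) * \<i>"
proof
  assume L: "\<alpha>\<^sup>2 + \<beta>\<^sup>2 = 1 \<and> z * w = of_real \<alpha> * w + of_real \<beta>"
  have w: "w * cnj w = 1"
    using assms(2) by (simp add: complex_norm_square[symmetric])
  have "z = z * w * cnj w"
    using w by (simp add: mult.assoc)
  also have "\<dots> = of_real \<alpha> + of_real \<beta> * cnj w"
    using L w by (simp add: distrib_right mult.assoc)
  finally have z: "Re z = \<alpha> + \<beta> * Re w" "Im z = - \<beta> * Im w"
    by simp_all
  have w2: "(Re w)\<^sup>2 + (Im w)\<^sup>2 = 1" and z2: "(Re z)\<^sup>2 + (Im z)\<^sup>2 = 1"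
    using assms(1,2) by (simp_all add: cmod_def)
  have "(Re z)\<^sup>2 + (Im z)\<^sup>2 = \<alpha>\<^sup>2 + 2 * \<alpha> * \<beta> * Re w + \<beta>\<^sup>2 * ((Re w)\<^sup>2 + (Im w)\<^sup>2)"
    unfolding z by (simp add: power2_eq_square algebra_simps)
  then have "2 * \<alpha> * \<beta> * Re w = 0"
    unfolding w2 z2 using L by linarith
  then have re: "Re w = 0"
    using assms by simp
  \<comment> \<open>So \<open>w\<close> is one of the two imaginary units, and
    \<open>Im z = - \<beta> * Im w\<close> yields the two signs of \<beta>.\<close>
  then have "Im w = 1 \<or> Im w = -1"
    using w2 by (simp add: power2_eq_1_iff)
  then show "Re z = \<alpha> \<and> Im z \<in> {\<beta>, - \<beta>} \<and> w = - of_real (Im z / \<beta>) * \<i>"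
    using z re assms by (auto simp: complex_eq_iff)
next
  assume R: "Re z = \<alpha> \<and> Im z \<in> {\<beta>, - \<beta>} \<and> w = - of_real (Im z / \<beta>) * \<i>"
  \<comment> \<open>The sign of \<open>Im z\<close> disappears on squaring.\<close>
  then have "\<alpha>\<^sup>2 + \<beta>\<^sup>2 = (norm z)\<^sup>2"
    by (auto simp: cmod_power2)
  then show "\<alpha>\<^sup>2 + \<beta>\<^sup>2 = 1 \<and> z * w = of_real \<alpha> * w + of_real \<beta>"
    using R assms by (auto simp: complex_eq_iff)
qed

section \<open>Fractional revival as scalar conditions on the eigenvalue support\<close>

theorem theorem2p4:
  fixes E :: "('v::finite \<times> 'v) set"
    and lam :: "nat \<Rightarrow> complex" and x :: "nat \<Rightarrow> complex^'v"
    and u v :: 'v and q :: "nat \<Rightarrow> real" and \<alpha> \<beta> t :: real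
  assumes "oriented_graph E"
    and "orthonormal_eigensystem E lam x"
    and "u \<noteq> v"
    and "strongly_cospectral_phases lam x u v q"
    and "\<alpha> \<noteq> 0" and "\<beta> \<noteq> 0"
  shows "fractional_revival E \<alpha> \<beta> u v t \<longleftrightarrow>
    (\<forall>r\<in>{1..CARD('v)}. lam r \<in> eigenvalue_support lam x u \<longrightarrow>
       Re (exp (lam r * of_real t)) = \<alpha> \<and>
       Im (exp (lam r * of_real t)) \<in> {\<beta>, -\<beta>} \<and>
       exp (\<i> * of_real (pi * q r)) = - of_real (Im (exp (lam r * of_real t)) / \<beta>) * \<i>)"
proof -
  let ?I = "{1..CARD('v)}"
  define \<omega> where "\<omega> r = exp (\<i> * of_real (pi * q r))" for r
  define z where "z r = exp (lam r * of_real t)" for r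
  define B where "B = t *\<^sub>R adj_matrix E"
  \<comment> \<open>The defect of the revival equation, moved to complex vectors so that it can be
    paired with each \<open>x r\<close>.\<close>
  define d where "d = (\<chi> i. of_real ((transition_matrix E t *v axis u 1) $ i)) -
    (of_real \<alpha> *s axis u 1 + of_real \<beta> *s axis v (1 :: complex))"
  have eig: "complex_matrix (adj_matrix E) *v x r = lam r *s x r" if "r \<in> ?I" for r
    using assms(2) that by (simp add: orthonormal_eigensystem_def)
  have on: "hermitian_inner (x r) (x s) = (if r = s then 1 else 0)" if "r \<in> ?I" "s \<in> ?I" for r s
    using assms(2) that by (simp add: orthonormal_eigensystem_def)
  have skew: "adj_matrix E $ j $ i = - (adj_matrix E $ i $ j)" for i j
    using assms(1) by (rule adj_matrix_skew)
  have imag: "cnj (lam r) = - lam r" if "r \<in> ?I" for r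
    using skew_eigenvalue_imaginary[OF skew eig[OF that]] on[OF that that] by simp
  have z1: "norm (z r) = 1" if "r \<in> ?I" for r
  proof -
    have "Re (lam r) = 0"
      using imag[OF that] by (simp add: complex_eq_iff)
    then show ?thesis by (simp add: z_def)
  qed
  have w1: "norm (\<omega> r) = 1" for r
    by (simp add: \<omega>_def)
  have nz: "x r \<noteq> 0" if "r \<in> ?I" for r
    using on[OF that that] by (auto simp: hermitian_inner_def)
  have phase: "cnj (x r $ u) = \<omega> r * cnj (x r $ v)" if r: "r \<in> ?I" for r
  proof -
    have "eigenprojection (x r) *v axis u 1 = \<omega> r *s (eigenprojection (x r) *v axis v 1)"
      using assms(4) r unfolding strongly_cospectral_phases_def \<omega>_def by blast
    \<comment> \<open>Both projections are multiples of the same nonzero vector \<open>x r\<close>,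
      so coefficients can be compared.\<close>
    then have "cnj (x r $ u) *s x r = (\<omega> r * cnj (x r $ v)) *s x r"
      by (simp only: eigenprojection_axis vector_smult_assoc)
    then show ?thesis
      using nz[OF r] by (simp add: vector_mul_rcancel)
  qed
  have same: "\<omega> r = \<omega> s" if "r \<in> ?I" "s \<in> ?I" "lam r = lam s" for r s
    using assms(4) that unfolding strongly_cospectral_phases_def \<omega>_def by blast
  have inner_d: "hermitian_inner (x r) d =
      z r * cnj (x r $ u) - (of_real \<alpha> * cnj (x r $ u) + of_real \<beta> * cnj (x r $ v))"
    if r: "r \<in> ?I" for r
  proof -
    \<comment> \<open>The left eigenvalue \<open>- cnj (lam r)\<close> is \<open>lam r\<close>
      itself, the spectrum being imaginary.\<close>
    have "(\<Sum>i\<in>UNIV. cnj (x r $ i) * of_real (B $ i $ j)) = lam r * of_real t * cnj (x r $ j)" for j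
    proof -
      have "(\<Sum>i\<in>UNIV. cnj (x r $ i) * of_real (B $ i $ j)) =
          of_real t * (\<Sum>i\<in>UNIV. cnj (x r $ i) * of_real (adj_matrix E $ i $ j))"
        by (simp add: B_def sum_distrib_left mult_ac)
      then show ?thesis
        by (simp add: skew_left_eigenvector[OF skew eig[OF r]] imag[OF r])
    qed
    then have "(\<Sum>i\<in>UNIV. cnj (x r $ i) * of_real (matrix_exp B $ i $ u)) = z r * cnj (x r $ u)"
      unfolding z_def by (rule left_eigenvector_matrix_exp)
    then have "hermitian_inner (x r) (\<chi> i. of_real ((transition_matrix E t *v axis u 1) $ i)) =
        z r * cnj (x r $ u)"
      by (simp add: hermitian_inner_def transition_matrix_def matrix_vector_mult_axis flip: B_def)
    moreover have "hermitian_inner a (b - c) = hermitian_inner a b - hermitian_inner a c"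
      for a b c :: "complex^'v"
      by (simp add: hermitian_inner_def right_diff_distrib sum_subtractf)
    ultimately show ?thesis
      by (simp add: d_def hermitian_inner_combination hermitian_inner_axis)
  qed
  have "transition_matrix E t *v axis u 1 = \<alpha> *\<^sub>R axis u 1 + \<beta> *\<^sub>R axis v 1 \<longleftrightarrow> d = 0"
  proof -
    have "of_real a = of_real \<alpha> * axis u 1 $ i + of_real \<beta> * (axis v 1 :: complex^'v) $ i \<longleftrightarrow>
        a = \<alpha> * axis u 1 $ i + \<beta> * axis v 1 $ i" for a i
      by (auto simp: axis_def simp flip: of_real_add)
    then show ?thesis
      by (simp add: d_def vec_eq_iff)
  qed
  also have "d = 0 \<longleftrightarrow> (\<forall>r\<in>?I. hermitian_inner (x r) d = 0)"
    using orthonormal_complete[OF on, of d] by (auto simp: hermitian_inner_def)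
  also have "\<dots> \<longleftrightarrow> (\<forall>r\<in>?I. x r $ u \<noteq> 0 \<longrightarrow> z r * \<omega> r = of_real \<alpha> * \<omega> r + of_real \<beta>)"
  proof (rule ball_cong[OF refl])
    fix r assume r: "r \<in> ?I"
    have w0: "\<omega> r \<noteq> 0" using w1[of r] by auto
    \<comment> \<open>The phase relation lets \<open>cnj (x r $ v)\<close> be factored out; it
      vanishes exactly when \<open>x r $ u\<close> does, so only indices with
      \<open>x r $ u \<noteq> 0\<close> impose a condition.\<close>
    have "hermitian_inner (x r) d =
        (z r * \<omega> r - (of_real \<alpha> * \<omega> r + of_real \<beta>)) * cnj (x r $ v)"
      unfolding inner_d[OF r] phase[OF r] by (simp add: algebra_simps)
    moreover have "x r $ u = 0 \<longleftrightarrow> x r $ v = 0"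
      using phase[OF r] w0 by (metis complex_cnj_zero_iff mult_eq_0_iff)
    ultimately show "hermitian_inner (x r) d = 0 \<longleftrightarrow>
        (x r $ u \<noteq> 0 \<longrightarrow> z r * \<omega> r = of_real \<alpha> * \<omega> r + of_real \<beta>)"
      by auto
  qed
  finally have revival: "fractional_revival E \<alpha> \<beta> u v t \<longleftrightarrow> \<alpha>\<^sup>2 + \<beta>\<^sup>2 = 1 \<and>
      (\<forall>r\<in>?I. x r $ u \<noteq> 0 \<longrightarrow> z r * \<omega> r = of_real \<alpha> * \<omega> r + of_real \<beta>)"
    using assms(3,6) by (simp add: fractional_revival_def)
  \<comment> \<open>In the converse direction \<alpha>^2 + \<beta>^2 = 1 has to come from some
    index, so the condition must not be vacuous.\<close>
  obtain r0 where r0: "r0 \<in> ?I" "x r0 $ u \<noteq> 0"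
  proof -
    have "axis u 1 \<noteq> (0 :: complex^'v)" by (simp add: axis_eq_0_iff)
    then have "\<exists>r\<in>?I. hermitian_inner (x r) (axis u 1) \<noteq> 0"
      using orthonormal_complete[OF on, of "axis u 1"] by blast
    then show ?thesis using that by (auto simp: hermitian_inner_axis)
  qed
  let ?C = "\<lambda>r. Re (z r) = \<alpha> \<and> Im (z r) \<in> {\<beta>, - \<beta>} \<and> \<omega> r = - of_real (Im (z r) / \<beta>) * \<i>"
  have "fractional_revival E \<alpha> \<beta> u v t \<longleftrightarrow> (\<forall>r\<in>?I. x r $ u \<noteq> 0 \<longrightarrow> ?C r)"
    unfolding revival using unit_phase_equation_iff[OF z1 w1 assms(5,6)] r0 by blast
  also have "\<dots> \<longleftrightarrow> (\<forall>r\<in>?I. lam r \<in> eigenvalue_support lam x u \<longrightarrow> ?C r)"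
  proof -
    \<comment> \<open>For a repeated eigenvalue, membership in the support may be witnessed by an
      index other than \<open>r\<close>. The condition \<open>?C\<close> transfers because equal
      eigenvalues have equal phase factors.\<close>
    have supp: "lam r \<in> eigenvalue_support lam x u \<longleftrightarrow>
        (\<exists>s\<in>?I. lam s = lam r \<and> x s $ u \<noteq> 0)" for r
      using nz by (auto simp: eigenvalue_support_def eigenprojection_axis vector_mul_eq_0) metis+
    have "?C r \<longleftrightarrow> ?C s" if "r \<in> ?I" "s \<in> ?I" "lam s = lam r" for r s
      using same[of r s] that by (simp add: z_def)
    then show ?thesis unfolding supp by blast
  qed
  finally show ?thesis unfolding z_def \<omega>_def .
qed

end
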